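(* Let $H_a$ denote the Haj\'os graph and let $K_{1,n}$ denote the star with $n$ edges. Then \[ R(H_a,K_{1,n})=\begin{cases} 2n+2 & \text{for every even integer } n\ge 2,\\ 2n+3 & \text{for every odd integer } n\ge 3.\end{cases} \]
   Context: All graphs are finite and simple. For graphs $G_1,G_2$, the Ramsey number $R(G_1,G_2)$ is the smallest positive integer $N$ such that for every graph $\Gamma$ on $N$ vertices, either $\Gamma$ contains $G_1$ as a (not necessarily induced) subgraph, or the complement $\overline{\Gamma}$ contains $G_2$ as a (not necessarily induced) subgraph. The Haj\'os graph $H_a$ is the graph with six vertices and nine edges obtained from a triangle by adding, for each of its three edges, a new vertex joined to exactly the two endpoints of that edge; explicitly, it has vertices $a,b,c,x,y,z$ and edges $ab,bc,ca,xa,xb,yb,yc,zc,za$. The star $K_{1,n}$ is the graph on $n+1$ vertices consisting of one center vertex adjacent to $n$ pairwise non-adjacent vertices. *)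

theory Defs
  imports Main
begin

type_synonym 'a graph = "'a set \<times> 'a set set"

abbreviation verts :: "'a graph \<Rightarrow> 'a set" where "verts \<equiv> fst"
abbreviation edges :: "'a graph \<Rightarrow> 'a set set" where "edges \<equiv> snd"

definition simple_graph :: "'a graph \<Rightarrow> bool" where
  "simple_graph G \<longleftrightarrow> finite (verts G) \<and> (\<forall>e\<in>edges G. e \<subseteq> verts G \<and> card e = 2)"

definition complement :: "'a graph \<Rightarrow> 'a graph" where
  "complement G = (verts G, {e. e \<subseteq> verts G \<and> card e = 2 \<and> e \<notin> edges G})"

text \<open>An isomorphic copy of \<open>H\<close> occurs in \<open>G\<close>, not necessarily as an induced subgraph.\<close>

definition contains_subgraph :: "'a graph \<Rightarrow> 'b graph \<Rightarrow> bool" where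
  "contains_subgraph G H \<longleftrightarrow>
     (\<exists>f. inj_on f (verts H) \<and> f ` verts H \<subseteq> verts G \<and> (\<forall>e\<in>edges H. f ` e \<in> edges G))"

text \<open>
  The host graphs range over all finite simple graphs with vertices in \<^typ>\<open>nat\<close>; up to
  isomorphism these are all finite simple graphs.
\<close>

definition ramsey_property :: "'a graph \<Rightarrow> 'b graph \<Rightarrow> nat \<Rightarrow> bool" where
  "ramsey_property G1 G2 N \<longleftrightarrow>
     (\<forall>\<Gamma> :: nat graph. simple_graph \<Gamma> \<and> card (verts \<Gamma>) = N \<longrightarrow>
        contains_subgraph \<Gamma> G1 \<or> contains_subgraph (complement \<Gamma>) G2)"

definition ramsey_number :: "'a graph \<Rightarrow> 'b graph \<Rightarrow> nat" where
  "ramsey_number G1 G2 = (LEAST N. N > 0 \<and> ramsey_property G1 G2 N)"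

datatype hajos_vertex = va | vb | vc | vx | vy | vz

definition hajos_graph :: "hajos_vertex graph" where
  "hajos_graph =
     ({va, vb, vc, vx, vy, vz},
      {{va, vb}, {vb, vc}, {vc, va}, {vx, va}, {vx, vb}, {vy, vb}, {vy, vc}, {vz, vc}, {vz, va}})"

text \<open>The star with centre \<open>0\<close> and leaves \<open>1, \<dots>, n\<close>.\<close>

definition star_graph :: "nat \<Rightarrow> nat graph" where
  "star_graph n = ({0..n}, {{0, i} | i. 1 \<le> i \<and> i \<le> n})"

lemma simple_graph_complement: "simple_graph G \<Longrightarrow> simple_graph (complement G)"
  by (auto simp: simple_graph_def complement_def)

lemma simple_graph_hajos: "simple_graph hajos_graph"
  by (simp add: simple_graph_def hajos_graph_def)

lemma card_hajos: "card (verts hajos_graph) = 6" "card (edges hajos_graph) = 9"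
  by (simp_all add: hajos_graph_def insert_eq_iff doubleton_eq_iff)

lemma simple_graph_star: "simple_graph (star_graph n)"
  by (auto simp: simple_graph_def star_graph_def card_insert_if)

end

theory Submission imports Defs begin

text \<open>
  The complement of a graph on $M$ vertices contains $K_{1,n}$ unless every vertex of the graph has
  degree at least $M - n$. So both values follow from one structural fact (\<open>four_dvd_card\<close>): a graph
  with $M \<ge> 6$ vertices and minimum degree at least $M/2 + 1$ that contains no Haj\'os graph has $M$
  divisible by $4$. For even $n$ it applies to $M = 2n + 2$, for odd $n$ to $M = 2n + 3$.

  To see the structural fact, note that any two vertices have at least two common neighbours. If the
  three vertices of a triangle had no common neighbour, then arbitrary further common neighbours of its
  three edges would be distinct and complete a Haj\'os graph; hence every triangle lies in some
  4-clique $K$. Two different vertices outside $K$ cannot be attached to two edges of $K$ that share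
  exactly one vertex: these edges span a triangle whose third edge is completed by the fourth vertex of
  $K$ (\<open>overlapping_pairs\<close>). On the other hand, the degree bound makes the vertices outside
  $K$ have at least two neighbours in $K$ on average. Together these force exactly two neighbours for each of
  them, and degree exactly $M/2 + 1$ for each vertex of $K$.

  Let $a, b \<in> K$ have a common neighbour outside $K$. By the above, every neighbour of $a$
  other than $b$ is also a neighbour of $b$, so the common neighbourhood $P$ of $a$ and $b$ has size $M/2$.
  Every $u \<in> P$ lies in a 4-clique with $a$ and $b$, which supplies a neighbour of $u$ in $P$. A second
  neighbour of $u$ in $P$ would see three vertices of that clique. So the graph induces a
  perfect matching on $P$, and $M/2$ is even.

  The lower bounds come from complete bipartite graphs with a few edges added inside the parts:
  $K_{n+1,n+1}$ with a perfect matching in each part, which requires $n + 1$ to be even, and otherwise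
  $K_{n+1,n}$ with a spanning star in the larger part.
\<close>

section \<open>Dense graphs without a Haj\'os subgraph\<close>

text \<open>
  A graph is given by its vertex set and its neighbourhood function. In \<open>has_hajos\<close> only those
  coincidences among the six vertices are excluded that irreflexivity leaves possible.
  The bound on \<open>card V\<close> excludes $K_5$, which meets all the other conditions.
\<close>

definition has_hajos :: "('a \<Rightarrow> 'a set) \<Rightarrow> bool" where
  "has_hajos N \<longleftrightarrow> (\<exists>a b c x y z.
     b \<in> N a \<and> c \<in> N b \<and> a \<in> N c \<and> x \<in> N a \<and> x \<in> N b \<and> y \<in> N b \<and> y \<in> N c \<and> z \<in> N c \<and> z \<in> N a \<and>
     x \<notin> {c, y, z} \<and> y \<notin> {a, z} \<and> z \<noteq> b)"

definition dense_hajos_free :: "'a set \<Rightarrow> ('a \<Rightarrow> 'a set) \<Rightarrow> bool" where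
  "dense_hajos_free V N \<longleftrightarrow>
     finite V \<and> (\<forall>v. N v \<subseteq> V) \<and> (\<forall>u v. u \<in> N v \<longrightarrow> v \<in> N u) \<and> (\<forall>v. v \<notin> N v) \<and>
     6 \<le> card V \<and> (\<forall>v\<in>V. card V + 2 \<le> 2 * card (N v)) \<and> \<not> has_hajos N"

lemma
  assumes "dense_hajos_free V N"
  shows finite_V: "finite V"
    and N_subset: "N v \<subseteq> V"
    and N_sym: "u \<in> N v \<Longrightarrow> v \<in> N u"
    and N_irrefl: "v \<notin> N v"
    and card_V: "6 \<le> card V"
    and degree: "v \<in> V \<Longrightarrow> card V + 2 \<le> 2 * card (N v)"
  using assms by (simp_all add: dense_hajos_free_def)

lemma no_hajos:
  assumes "dense_hajos_free V N"
    and "b \<in> N a" "c \<in> N b" "a \<in> N c" "x \<in> N a" "x \<in> N b" "y \<in> N b" "y \<in> N c" "z \<in> N c" "z \<in> N a"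
    and "x \<notin> {c, y, z}" "y \<notin> {a, z}" "z \<noteq> b"
  shows False
proof -
  have "has_hajos N"
    unfolding has_hajos_def
    by (rule exI[of _ a], rule exI[of _ b], rule exI[of _ c], rule exI[of _ x], rule exI[of _ y],
        rule exI[of _ z], use assms(2-) in simp)
  then show False using assms(1) by (simp add: dense_hajos_free_def)
qed

lemma finite_N:
  assumes G: "dense_hajos_free V N"
  shows "finite (N v)"
  using N_subset[OF G] finite_V[OF G] finite_subset by blast

lemma codegree:
  assumes G: "dense_hajos_free V N" and *: "u \<in> V" "v \<in> V"
  shows "2 \<le> card (N u \<inter> N v)"
proof -
  have "card (N u \<union> N v) \<le> card V"
    by (rule card_mono) (use finite_V[OF G] N_subset[OF G] in auto)
  then show ?thesis
    using card_Un_Int[OF finite_N[OF G] finite_N[OF G], of u v] degree[OF G *(1)] degree[OF G *(2)] by linarith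
qed

lemma common_neighbour:
  assumes G: "dense_hajos_free V N" and *: "v \<in> N u"
  obtains x where "x \<in> N u" "x \<in> N v" "x \<noteq> c"
proof -
  have "u \<in> V" "v \<in> V" using * N_sym[OF G] N_subset[OF G] by blast+
  from codegree[OF G this] have "\<not> N u \<inter> N v \<subseteq> {c}"
    using card_mono[of "{c}" "N u \<inter> N v"] by auto
  then show ?thesis using that by blast
qed

text \<open>
  Without a common neighbour of \<open>a\<close>, \<open>b\<close>, \<open>c\<close>, outer vertices chosen for the three edges separately
  are automatically distinct.
\<close>

lemma triangle_in_4_clique:
  assumes G: "dense_hajos_free V N" and *: "b \<in> N a" "c \<in> N b" "a \<in> N c"
  obtains d where "d \<in> N a" "d \<in> N b" "d \<in> N c"
proof -
  obtain x where x: "x \<in> N a" "x \<in> N b" "x \<noteq> c" using common_neighbour[OF G *(1)] .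
  obtain y where y: "y \<in> N b" "y \<in> N c" "y \<noteq> a" using common_neighbour[OF G *(2)] .
  obtain z where z: "z \<in> N c" "z \<in> N a" "z \<noteq> b" using common_neighbour[OF G *(3)] .
  show ?thesis
    using no_hajos[OF G * x(1,2) y(1,2) z(1,2)] x y z that by blast
qed

definition clique4 :: "'a set \<Rightarrow> ('a \<Rightarrow> 'a set) \<Rightarrow> 'a set \<Rightarrow> bool" where
  "clique4 V N K \<longleftrightarrow> card K = 4 \<and> K \<subseteq> V \<and> (\<forall>u\<in>K. \<forall>v\<in>K. u \<noteq> v \<longrightarrow> u \<in> N v)"

lemma clique4I:
  assumes G: "dense_hajos_free V N" and *: "b \<in> N a" "c \<in> N a" "c \<in> N b" "d \<in> N a" "d \<in> N b" "d \<in> N c"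
  shows "clique4 V N {a, b, c, d}"
proof -
  have "distinct [a, b, c, d]" using * N_irrefl[OF G] by auto
  moreover have "{a, b, c, d} \<subseteq> V" using * N_sym[OF G] N_subset[OF G] by blast
  moreover note * *[THEN N_sym[OF G]]
  ultimately show ?thesis by (simp add: clique4_def)
qed

text \<open>
  Otherwise the triangle \<open>p\<close>, \<open>q\<close>, \<open>r\<close> is the centre of a Haj\'os graph: \<open>v\<close> and \<open>w\<close> serve the
  edges at \<open>q\<close>, and the fourth vertex of the clique serves the edge between \<open>p\<close> and \<open>r\<close>.
\<close>

lemma overlapping_pairs:
  assumes G: "dense_hajos_free V N" and K: "clique4 V N K"
    and pqr: "p \<in> K" "q \<in> K" "r \<in> K" "p \<noteq> q" "q \<noteq> r" "p \<noteq> r"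
    and v: "v \<notin> K" "p \<in> N v" "q \<in> N v"
    and w: "w \<notin> K" "q \<in> N w" "r \<in> N w"
  shows "v = w"
proof (rule ccontr)
  assume "v \<noteq> w"
  have "\<not> K \<subseteq> {p, q, r}"
    using K card_mono[of "{p, q, r}" K] pqr by (auto simp: clique4_def)
  then obtain s where s: "s \<in> K" "s \<noteq> p" "s \<noteq> q" "s \<noteq> r" by blast
  have adj: "u \<in> N u'" if "u \<in> K" "u' \<in> K" "u \<noteq> u'" for u u'
    using K that by (auto simp: clique4_def)
  have inside: "q \<in> N p" "r \<in> N q" "p \<in> N r" "s \<in> N r" "s \<in> N p"
    using adj pqr s by simp_all
  have outside: "v \<in> N p" "v \<in> N q" "w \<in> N q" "w \<in> N r"
    using N_sym[OF G v(2)] N_sym[OF G v(3)] N_sym[OF G w(2)] N_sym[OF G w(3)] by simp_all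
  have "v \<notin> {r, w, s}" "w \<notin> {p, s}" using v(1) w(1) pqr s(1) \<open>v \<noteq> w\<close> by auto
  then show False using no_hajos[OF G inside(1-3) outside inside(4,5)] s(3) by simp
qed

lemma clique4_degree:
  assumes G: "dense_hajos_free V N" and *: "clique4 V N K" "k \<in> K"
  shows "card (N k) = card (N k - K) + 3"
proof -
  have "finite K" using * by (metis clique4_def card.infinite zero_neq_numeral)
  have "N k \<inter> K = K - {k}" using * N_irrefl[OF G] by (auto simp: clique4_def)
  then have "card (N k \<inter> K) = 3" using * \<open>finite K\<close> by (simp add: clique4_def)
  then show ?thesis
    using card_Int_Diff[OF finite_N[OF G], of k K] by simp
qed

lemma clique4_double_count:
  assumes G: "dense_hajos_free V N" and *: "clique4 V N K"
  shows "(\<Sum>w\<in>V - K. card (N w \<inter> K)) = (\<Sum>k\<in>K. card (N k - K))"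
proof -
  have fin: "finite K" "finite (V - K)"
    using * finite_V[OF G] finite_subset by (auto simp: clique4_def)
  have "(\<Sum>w\<in>V - K. card {k \<in> K. k \<in> N w}) = (\<Sum>k\<in>K. card (N k - K))"
  proof (rule sum_multicount_gen[OF fin(2) fin(1)], intro ballI)
    fix k assume "k \<in> K"
    have "{w \<in> V - K. k \<in> N w} = N k - K" using N_sym[OF G] N_subset[OF G] by blast
    then show "card {w \<in> V - K. k \<in> N w} = card (N k - K)" by simp
  qed
  moreover have "{k \<in> K. k \<in> N w} = N w \<inter> K" for w by blast
  ultimately show ?thesis by simp
qed

lemma card_outside_clique4:
  assumes G: "dense_hajos_free V N" and *: "clique4 V N K"
  shows "card (V - K) + 4 = card V"
  using * card_V[OF G] finite_V[OF G] card_Diff_subset[of K V] finite_subset[of K V]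
  by (auto simp: clique4_def)

text \<open>
  On average, a vertex outside a 4-clique has at least two neighbours in it: the four vertices of the clique
  send at least \<open>4 * (card V / 2 - 2)\<close> edges to the \<open>card V - 4\<close> vertices outside.
\<close>

lemma clique4_count_ge:
  assumes G: "dense_hajos_free V N" and *: "clique4 V N K"
  shows "4 * card (V - K) \<le> 2 * (\<Sum>w\<in>V - K. card (N w \<inter> K))"
proof -
  have "card V \<le> 2 * card (N k - K) + 4" if "k \<in> K" for k
    using degree[OF G, of k] clique4_degree[OF G * that] that * by (auto simp: clique4_def)
  then have "(\<Sum>k\<in>K. card (V - K)) \<le> (\<Sum>k\<in>K. 2 * card (N k - K))"
    using card_outside_clique4[OF G *] by (intro sum_mono) force
  then show ?thesis
    using * by (simp add: clique4_double_count[OF G] sum_distrib_left clique4_def)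
qed

text \<open>
  A vertex with three neighbours in the clique would leave at most one to every other outside vertex,
  by \<open>overlapping_pairs\<close>. The average of two then permits at most three outside vertices, and
  in such a small graph an outside vertex other than \<open>v\<close> has too small a degree.
\<close>

lemma at_most_two_in_clique4:
  assumes G: "dense_hajos_free V N" and K: "clique4 V N K" and v: "v \<in> V - K"
  shows "card (N v \<inter> K) \<le> 2"
proof (rule ccontr)
  assume "\<not> ?thesis"
  then have v3: "3 \<le> card (N v \<inter> K)" by simp
  have finK: "finite K" and cardK: "card K = 4"
    using K finite_V[OF G] finite_subset by (auto simp: clique4_def)
  have le1: "card (N w \<inter> K) \<le> 1" if w: "w \<in> V - K" "w \<noteq> v" for w
  proof (rule ccontr)
    assume "\<not> ?thesis"
    then have "2 \<le> card (N w \<inter> K)" by simp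
    then obtain S where "S \<subseteq> N w \<inter> K" "card S = 2" by (metis obtain_subset_with_card_n)
    then obtain p q where pq: "p \<in> N w \<inter> K" "q \<in> N w \<inter> K" "p \<noteq> q"
      by (auto simp: card_2_iff)
    have "\<not> N v \<inter> K \<subseteq> {p, q}"
      using v3 card_mono[of "{p, q}" "N v \<inter> K"] pq by auto
    then obtain r where r: "r \<in> N v" "r \<in> K" "r \<noteq> p" "r \<noteq> q" by blast
    \<comment> \<open>\<open>v\<close> misses at most one vertex of the clique.\<close>
    have "p \<in> N v \<or> q \<in> N v"
    proof (rule ccontr)
      assume "\<not> ?thesis"
      then have "N v \<inter> K \<subseteq> K - {p, q}" by blast
      then have "card (N v \<inter> K) \<le> card (K - {p, q})" using finK by (intro card_mono) auto
      then show False using v3 pq finK cardK by (simp add: card_Diff_subset)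
    qed
    then show False
      using overlapping_pairs[OF G K, of p q r w v] overlapping_pairs[OF G K, of q p r w v] pq r v w
      by blast
  qed
  let ?O = "V - K"
  have finO: "finite ?O" using finite_V[OF G] by simp
  have "(\<Sum>w\<in>?O. card (N w \<inter> K)) = card (N v \<inter> K) + (\<Sum>w\<in>?O - {v}. card (N w \<inter> K))"
    using sum.remove[OF finO v] .
  also have "\<dots> \<le> 4 + (\<Sum>w\<in>?O - {v}. 1)"
    by (intro add_mono sum_mono) (use le1 cardK finK card_mono[of K "N v \<inter> K"] in auto)
  finally have "2 * card ?O \<le> 4 + (card ?O - 1)"
    using clique4_count_ge[OF G K] v finO by simp
  then have small: "card V \<le> 7" using card_outside_clique4[OF G K] by linarith
  have "\<not> ?O \<subseteq> {v}"
    using card_outside_clique4[OF G K] card_V[OF G] card_mono[of "{v}" ?O] by auto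
  then obtain w where w: "w \<in> ?O" "w \<noteq> v" by blast
  have "card (N w) \<le> card (N w \<inter> K) + card (?O - {w})"
  proof -
    have "N w \<subseteq> (N w \<inter> K) \<union> (?O - {w})" using N_subset[OF G] N_irrefl[OF G] by blast
    then have "card (N w) \<le> card ((N w \<inter> K) \<union> (?O - {w}))"
      using finK finO by (intro card_mono) auto
    also have "\<dots> \<le> card (N w \<inter> K) + card (?O - {w})" by (rule card_Un_le)
    finally show ?thesis .
  qed
  then have "card (N w) \<le> card ?O" using le1[OF w] w finO card_gt_0_iff[of ?O] by auto
  then show False
    using degree[OF G, of w] w small card_outside_clique4[OF G K] card_V[OF G] by auto
qed

lemma exactly_two_in_clique4:
  assumes G: "dense_hajos_free V N" and K: "clique4 V N K" and v: "v \<in> V - K"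
  shows "card (N v \<inter> K) = 2"
proof (rule ccontr)
  assume "\<not> ?thesis"
  then have "card (N v \<inter> K) < 2" using at_most_two_in_clique4[OF G K v] by simp
  then have "(\<Sum>w\<in>V - K. card (N w \<inter> K)) < (\<Sum>w\<in>V - K. 2)"
    using at_most_two_in_clique4[OF G K] v finite_V[OF G] by (intro sum_strict_mono_ex1) auto
  then show False using clique4_count_ge[OF G K] by simp
qed

text \<open>
  Now the lower bound of \<open>clique4_count_ge\<close> is attained, so no vertex of the clique can exceed the
  minimum degree that this bound assumes.
\<close>

lemma degree_in_clique4:
  assumes G: "dense_hajos_free V N" and K: "clique4 V N K" and k: "k \<in> K"
  shows "2 * card (N k) = card V + 2"
proof (rule ccontr)
  have finK: "finite K" and cardK: "card K = 4" and KV: "K \<subseteq> V"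
    using K finite_V[OF G] finite_subset by (auto simp: clique4_def)
  assume "\<not> ?thesis"
  then have "card V + 2 < 2 * card (N k)" using degree[OF G, of k] k KV by auto
  then have "(\<Sum>k\<in>K. card V + 2) < (\<Sum>k\<in>K. 2 * card (N k))"
    using degree[OF G] k KV finK by (intro sum_strict_mono_ex1) auto
  also have "\<dots> = (\<Sum>k\<in>K. 2 * card (N k - K) + 6)"
    by (rule sum.cong) (use clique4_degree[OF G K] in auto)
  also have "\<dots> = 2 * (\<Sum>w\<in>V - K. card (N w \<inter> K)) + 24"
    using cardK by (simp add: clique4_double_count[OF G K] sum.distrib sum_distrib_left)
  also have "\<dots> = 4 * card (V - K) + 24"
    using exactly_two_in_clique4[OF G K] by simp
  finally show False using card_outside_clique4[OF G K] cardK by simp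
qed

text \<open>
  A neighbour of \<open>a\<close> outside \<open>K\<close> that misses \<open>b\<close> would have its second neighbour in \<open>K\<close> elsewhere,
  which conflicts with \<open>v\<close> by \<open>overlapping_pairs\<close>.
\<close>

lemma clique4_twins:
  assumes G: "dense_hajos_free V N" and K: "clique4 V N K" and ab: "a \<in> K" "b \<in> K" "a \<noteq> b"
    and v: "v \<in> V - K" "a \<in> N v" "b \<in> N v"
  shows "N a - {b} = N a \<inter> N b"
proof -
  have "w \<in> N b" if w: "w \<in> N a" "w \<noteq> b" for w
  proof (cases "w \<in> K")
    case True
    then show ?thesis using K ab w by (auto simp: clique4_def)
  next
    case False
    show ?thesis
    proof (rule ccontr)
      assume wb: "w \<notin> N b"
      have "w \<in> V - K" using False w N_subset[OF G] by blast
      then have "card (N w \<inter> K) = 2" using exactly_two_in_clique4[OF G K] by blast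
      then have "\<not> N w \<inter> K \<subseteq> {a}" using card_mono[of "{a}" "N w \<inter> K"] by auto
      then obtain r where r: "r \<in> N w" "r \<in> K" "r \<noteq> a" by blast
      have "r \<noteq> b" using r wb N_sym[OF G] by blast
      have "w = v"
        using overlapping_pairs[OF G K r(2) ab(1,2) r(3) ab(3) \<open>r \<noteq> b\<close>, of w v] False r w v N_sym[OF G]
        by blast
      then show False using v wb N_sym[OF G] by blast
    qed
  qed
  then show ?thesis using N_irrefl[OF G] by blast
qed

lemma clique4_exists:
  assumes G: "dense_hajos_free V N"
  shows "\<exists>K. clique4 V N K"
proof -
  obtain a where "a \<in> V" using card_V[OF G] by fastforce
  then obtain b where b: "b \<in> N a" using degree[OF G, of a] by fastforce
  obtain c where c: "c \<in> N a" "c \<in> N b" using common_neighbour[OF G b] .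
  obtain d where "d \<in> N a" "d \<in> N b" "d \<in> N c"
    using triangle_in_4_clique[OF G b c(2) N_sym[OF G c(1)]] .
  then show ?thesis using clique4I[OF G b c] by blast
qed

lemma even_card_perfect_matching:
  assumes G: "dense_hajos_free V N" and *: "finite P" and m: "\<And>v. v \<in> P \<Longrightarrow> \<exists>!w. w \<in> P \<and> w \<in> N v"
  shows "even (card P)"
proof -
  define f where "f v = (THE w. w \<in> P \<and> w \<in> N v)" for v
  have f: "f v \<in> P" "f v \<in> N v" if "v \<in> P" for v
    using theI'[OF m[OF that]] by (auto simp: f_def)
  have funiq: "w = f v" if "v \<in> P" "w \<in> P" "w \<in> N v" for v w
    using m[OF that(1)] f[OF that(1)] that(2,3) by blast
  have ff: "f (f v) = v" if "v \<in> P" for v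
    using funiq[of "f v" v] f[OF that] that N_sym[OF G] by auto
  have "2 * card ((\<lambda>v. {v, f v}) ` P) = card (\<Union>((\<lambda>v. {v, f v}) ` P))"
  proof (rule card_partition)
    fix c assume "c \<in> (\<lambda>v. {v, f v}) ` P"
    then obtain v where v: "v \<in> P" "c = {v, f v}" by auto
    then have "f v \<noteq> v" using f(2)[of v] N_irrefl[OF G, of v] by auto
    then show "card c = 2" using v(2) by simp
  next
    fix c d assume cd: "c \<in> (\<lambda>v. {v, f v}) ` P" "d \<in> (\<lambda>v. {v, f v}) ` P" "c \<noteq> d"
    \<comment> \<open>Each of these pairs is determined by either of its elements.\<close>
    have pair: "e = {t, f t}" if "t \<in> e" "e \<in> (\<lambda>v. {v, f v}) ` P" for t e
      using that ff by auto
    show "c \<inter> d = {}"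
    proof (rule ccontr)
      assume "c \<inter> d \<noteq> {}"
      then obtain t where "t \<in> c" "t \<in> d" by auto
      from pair[OF this(1) cd(1)] pair[OF this(2) cd(2)] show False using cd(3) by simp
    qed
  qed (use * f in auto)
  moreover have "\<Union>((\<lambda>v. {v, f v}) ` P) = P" using f by auto
  ultimately show ?thesis by (metis dvd_triv_left)
qed

text \<open>
  Two vertices \<open>a\<close>, \<open>b\<close> of a 4-clique with a common neighbour outside it have \<open>card V / 2\<close> common
  neighbours, by \<open>clique4_twins\<close> and \<open>degree_in_clique4\<close>. The 4-cliques through \<open>a\<close> and \<open>b\<close>
  match these common neighbours in pairs.
\<close>

lemma four_dvd_card:
  assumes G: "dense_hajos_free V N"
  shows "4 dvd card V"
proof -
  obtain K where K: "clique4 V N K" using clique4_exists[OF G] by blast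
  have "V - K \<noteq> {}" using card_outside_clique4[OF G K] card_V[OF G] by force
  then obtain v where v: "v \<in> V - K" by blast
  obtain a b where ab: "a \<in> K" "b \<in> K" "a \<in> N v" "b \<in> N v" "a \<noteq> b"
    using exactly_two_in_clique4[OF G K v] unfolding card_2_iff by blast
  have adj: "b \<in> N a" using K ab(1,2,5) by (simp add: clique4_def)
  let ?P = "N a \<inter> N b"
  have "card ?P + 1 = card (N a)"
    using clique4_twins[OF G K ab(1,2,5) v ab(3,4)] adj finite_N[OF G]
    by (metis Suc_eq_plus1 card_Suc_Diff1)
  then have cardP: "2 * card ?P = card V" using degree_in_clique4[OF G K ab(1)] by linarith
  have "\<exists>!w. w \<in> ?P \<and> w \<in> N u" if u: "u \<in> ?P" for u
  proof -
    obtain w where w: "w \<in> N a" "w \<in> N b" "w \<in> N u"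
      using triangle_in_4_clique[OF G adj, of u] u N_sym[OF G] by blast
    have L: "clique4 V N {a, b, u, w}" using clique4I[OF G adj _ _ w] u by blast
    \<comment> \<open>Any other \<open>x\<close> would have the three neighbours \<open>a\<close>, \<open>b\<close>, \<open>u\<close> in this clique.\<close>
    have "x = w" if x: "x \<in> ?P" "x \<in> N u" for x
    proof (rule ccontr)
      assume "x \<noteq> w"
      then have "x \<in> V - {a, b, u, w}" using x N_irrefl[OF G] N_subset[OF G] by blast
      from exactly_two_in_clique4[OF G L this]
      have "card (N x \<inter> {a, b, u, w}) = 2" .
      moreover have "{a, b, u} \<subseteq> N x \<inter> {a, b, u, w}" using x N_sym[OF G] by blast
      then have "card {a, b, u} \<le> card (N x \<inter> {a, b, u, w})" by (intro card_mono) auto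
      moreover have "card {a, b, u} = 3"
      proof -
        have "a \<noteq> b" "a \<noteq> u" "b \<noteq> u" using adj u N_irrefl[OF G] by blast+
        then show ?thesis by simp
      qed
      ultimately show False by simp
    qed
    then show ?thesis using w by blast
  qed
  from even_card_perfect_matching[OF G _ this] have "even (card ?P)" using finite_N[OF G] by blast
  then obtain k where "card ?P = 2 * k" by (rule evenE)
  then have "card V = 4 * k" using cardP by simp
  then show ?thesis by simp
qed

section \<open>Subgraph containment in terms of neighbourhoods\<close>

definition neighbours :: "'a graph \<Rightarrow> 'a \<Rightarrow> 'a set" where
  "neighbours G v = {u. {u, v} \<in> edges G}"

lemma neighbours_facts:
  assumes "simple_graph G"
  shows "neighbours G v \<subseteq> verts G" "v \<notin> neighbours G v"
    "u \<in> neighbours G v \<Longrightarrow> v \<in> neighbours G u"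
  using assms by (auto simp: neighbours_def simple_graph_def insert_commute)

lemma contains_hajosI:
  assumes G: "simple_graph G" and "has_hajos (neighbours G)"
  shows "contains_subgraph G hajos_graph"
proof -
  obtain a b c x y z where
    e: "b \<in> neighbours G a" "c \<in> neighbours G b" "a \<in> neighbours G c"
      "x \<in> neighbours G a" "x \<in> neighbours G b" "y \<in> neighbours G b" "y \<in> neighbours G c"
      "z \<in> neighbours G c" "z \<in> neighbours G a"
    and d: "x \<notin> {c, y, z}" "y \<notin> {a, z}" "z \<noteq> b"
    using assms(2) unfolding has_hajos_def by (elim exE conjE)
  let ?f = "case_hajos_vertex a b c x y z"
  have "distinct [a, b, c, x, y, z]"
    using e d neighbours_facts(2)[OF G] by auto
  then have "inj_on ?f (verts hajos_graph)"
    by (auto simp: hajos_graph_def inj_on_def)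
  moreover have "?f ` verts hajos_graph \<subseteq> verts G"
    using e neighbours_facts(1)[OF G] by (auto simp: hajos_graph_def)
  moreover have "\<forall>e\<in>edges hajos_graph. ?f ` e \<in> edges G"
    using e by (auto simp: hajos_graph_def neighbours_def insert_commute)
  ultimately show ?thesis unfolding contains_subgraph_def by blast
qed

lemma contains_hajosE:
  assumes "contains_subgraph G hajos_graph"
  obtains a b c x y z where "distinct [a, b, c, x, y, z]"
    "{a, b} \<in> edges G" "{b, c} \<in> edges G" "{a, c} \<in> edges G" "{a, x} \<in> edges G" "{b, x} \<in> edges G"
    "{b, y} \<in> edges G" "{c, y} \<in> edges G" "{c, z} \<in> edges G" "{a, z} \<in> edges G"
proof -
  obtain f where f: "inj_on f (verts hajos_graph)" "\<forall>e\<in>edges hajos_graph. f ` e \<in> edges G"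
    using assms unfolding contains_subgraph_def by blast
  have d: "distinct [f va, f vb, f vc, f vx, f vy, f vz]"
    using f(1) by (simp add: hajos_graph_def)
  have e: "{f va, f vb} \<in> edges G" "{f vb, f vc} \<in> edges G" "{f vc, f va} \<in> edges G"
    "{f vx, f va} \<in> edges G" "{f vx, f vb} \<in> edges G" "{f vy, f vb} \<in> edges G"
    "{f vy, f vc} \<in> edges G" "{f vz, f vc} \<in> edges G" "{f vz, f va} \<in> edges G"
    using f(2) by (simp_all add: hajos_graph_def)
  show ?thesis
    by (rule that[OF d e(1,2)]) (use e(3-9) in \<open>simp_all only: insert_commute\<close>)
qed

lemma neighbours_complement:
  assumes "simple_graph G" "v \<in> verts G"
  shows "neighbours (complement G) v = verts G - insert v (neighbours G v)"
  using assms by (auto simp: neighbours_def complement_def card_2_iff doubleton_eq_iff)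

lemma contains_star_iff:
  assumes G: "simple_graph G"
  shows "contains_subgraph G (star_graph n) \<longleftrightarrow> (\<exists>v\<in>verts G. n \<le> card (neighbours G v))"
proof
  assume "contains_subgraph G (star_graph n)"
  then obtain f where f0: "inj_on f (verts (star_graph n))" "f ` verts (star_graph n) \<subseteq> verts G"
      "\<forall>e\<in>edges (star_graph n). f ` e \<in> edges G"
    unfolding contains_subgraph_def by blast
  have f: "inj_on f {0..n}" "f ` {0..n} \<subseteq> verts G"
      "\<And>i. 1 \<le> i \<Longrightarrow> i \<le> n \<Longrightarrow> f ` {0, i} \<in> edges G"
    using f0 by (auto simp: star_graph_def simp del: image_insert)
  have "f ` {1..n} \<subseteq> neighbours G (f 0)"
    using f(3) by (auto simp: neighbours_def insert_commute)
  moreover have "finite (neighbours G (f 0))"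
    by (rule finite_subset[OF neighbours_facts(1)[OF G]]) (use G in \<open>simp add: simple_graph_def\<close>)
  moreover have "card (f ` {1..n}) = n"
    using f(1) by (subst card_image) (auto simp: inj_on_def)
  ultimately have "n \<le> card (neighbours G (f 0))" by (metis card_mono)
  then show "\<exists>v\<in>verts G. n \<le> card (neighbours G v)"
    using f(2) by (intro bexI[of _ "f 0"]) auto
next
  assume "\<exists>v\<in>verts G. n \<le> card (neighbours G v)"
  then obtain v T where v: "v \<in> verts G" and T: "T \<subseteq> neighbours G v" "card T = n" "finite T"
    by (metis obtain_subset_with_card_n)
  obtain g where g: "bij_betw g {1..n} T"
    using T finite_same_card_bij[of "{1..n}" T] by auto
  let ?f = "\<lambda>i. if i = 0 then v else g i"
  have gT: "g i \<in> T" if "1 \<le> i" "i \<le> n" for i using g that by (auto simp: bij_betw_def)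
  have zero: "{0..n} = insert 0 {1..n}" by auto
  have "v \<notin> T" using T(1) neighbours_facts(2)[OF G] by (meson subsetD)
  moreover have "inj_on ?f {1..n} \<longleftrightarrow> inj_on g {1..n}"
    by (rule inj_on_cong) simp
  then have "inj_on ?f {1..n}" using g by (simp add: bij_betw_def)
  ultimately have "inj_on ?f {0..n}"
    using gT by (auto simp: zero inj_on_insert)
  moreover have "?f ` {0..n} \<subseteq> verts G"
    using v gT T(1) neighbours_facts(1)[OF G, of v] by (auto simp: zero dest!: subsetD)
  moreover have "?f ` {0, i} \<in> edges G" if "1 \<le> i" "i \<le> n" for i
    using gT[OF that] T that by (auto simp: neighbours_def insert_commute)
  ultimately show "contains_subgraph G (star_graph n)"
    unfolding contains_subgraph_def star_graph_def by (intro exI[of _ ?f]) auto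
qed

lemma complement_contains_star_iff:
  assumes G: "simple_graph G"
  shows "contains_subgraph (complement G) (star_graph n) \<longleftrightarrow>
    (\<exists>v\<in>verts G. card (neighbours G v) + n < card (verts G))"
proof -
  have "n \<le> card (neighbours (complement G) v) \<longleftrightarrow> card (neighbours G v) + n < card (verts G)"
    if v: "v \<in> verts G" for v
  proof -
    have fin: "finite (verts G)" using G by (simp add: simple_graph_def)
    have sub: "insert v (neighbours G v) \<subseteq> verts G" using v neighbours_facts(1)[OF G] by blast
    have "card (insert v (neighbours G v)) = card (neighbours G v) + 1"
      using neighbours_facts(2)[OF G, of v] fin sub finite_subset by (subst card_insert_disjoint) auto
    then show ?thesis
      using card_Diff_subset[OF finite_subset[OF sub fin] sub] card_mono[OF fin sub]
      by (auto simp: neighbours_complement[OF G v])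
  qed
  then show ?thesis
    using contains_star_iff[OF simple_graph_complement[OF G]] by (auto simp: complement_def)
qed

section \<open>Monotonicity and the upper bound\<close>

lemma contains_subgraph_mono:
  assumes "contains_subgraph A H" "verts A \<subseteq> verts B" "edges A \<subseteq> edges B"
  shows "contains_subgraph B H"
proof -
  obtain f where "inj_on f (verts H)" "f ` verts H \<subseteq> verts A" "\<forall>e\<in>edges H. f ` e \<in> edges A"
    using assms(1) unfolding contains_subgraph_def by blast
  then show ?thesis
    unfolding contains_subgraph_def using assms(2,3) by (intro exI[of _ f]) auto
qed

text \<open>
  A larger host is restricted to \<open>N\<close> of its vertices; this shrinks both the host and its complement.
\<close>

lemma ramsey_property_mono:
  assumes N: "ramsey_property G1 G2 N" and "N \<le> M"
  shows "ramsey_property G1 G2 M"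
  unfolding ramsey_property_def
proof (intro allI impI)
  fix \<Gamma> :: "nat graph" assume \<Gamma>: "simple_graph \<Gamma> \<and> card (verts \<Gamma>) = M"
  then obtain W where W: "W \<subseteq> verts \<Gamma>" "card W = N"
    using \<open>N \<le> M\<close> by (metis obtain_subset_with_card_n)
  let ?H = "(W, {e \<in> edges \<Gamma>. e \<subseteq> W})"
  have "simple_graph ?H" using \<Gamma> W finite_subset by (auto simp: simple_graph_def)
  then have "contains_subgraph ?H G1 \<or> contains_subgraph (complement ?H) G2"
    using N W by (auto simp: ramsey_property_def)
  moreover have "verts ?H \<subseteq> verts \<Gamma>" "edges ?H \<subseteq> edges \<Gamma>"
    "verts (complement ?H) \<subseteq> verts (complement \<Gamma>)" "edges (complement ?H) \<subseteq> edges (complement \<Gamma>)"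
    using W by (auto simp: complement_def)
  ultimately show "contains_subgraph \<Gamma> G1 \<or> contains_subgraph (complement \<Gamma>) G2"
    using contains_subgraph_mono[of ?H G1 \<Gamma>]
      contains_subgraph_mono[of "complement ?H" G2 "complement \<Gamma>"] by argo
qed

lemma ramsey_number_eqI:
  assumes "ramsey_property G1 G2 (Suc N)" "\<not> ramsey_property G1 G2 N"
  shows "ramsey_number G1 G2 = Suc N"
  unfolding ramsey_number_def
proof (rule Least_equality)
  show "0 < Suc N \<and> ramsey_property G1 G2 (Suc N)" using assms by simp
  show "Suc N \<le> M" if "0 < M \<and> ramsey_property G1 G2 M" for M
    using that assms(2) ramsey_property_mono[of G1 G2 M N] by (metis not_less_eq_eq)
qed

text \<open>
  A host whose complement has no star with \<open>n\<close> edges has minimum degree at least \<open>M - n\<close>, and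
  \<open>2 * (M - n) \<ge> M + 2\<close> is the degree condition of \<open>dense_hajos_free\<close>.
\<close>

lemma hajos_star_upper:
  assumes "6 \<le> M" "2 * n + 2 \<le> M" "\<not> 4 dvd M"
  shows "ramsey_property hajos_graph (star_graph n) M"
  unfolding ramsey_property_def
proof (intro allI impI)
  fix \<Gamma> :: "nat graph" assume "simple_graph \<Gamma> \<and> card (verts \<Gamma>) = M"
  then have G: "simple_graph \<Gamma>" and M: "card (verts \<Gamma>) = M" by auto
  show "contains_subgraph \<Gamma> hajos_graph \<or> contains_subgraph (complement \<Gamma>) (star_graph n)"
  proof (rule ccontr)
    assume "\<not> ?thesis"
    then have no_hajos: "\<not> contains_subgraph \<Gamma> hajos_graph"
      and deg: "\<And>v. v \<in> verts \<Gamma> \<Longrightarrow> M \<le> card (neighbours \<Gamma> v) + n"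
      using complement_contains_star_iff[OF G] M by (auto simp: not_less)
    have "card (verts \<Gamma>) + 2 \<le> 2 * card (neighbours \<Gamma> v)" if "v \<in> verts \<Gamma>" for v
      using deg[OF that] assms M by linarith
    moreover have "\<not> has_hajos (neighbours \<Gamma>)" using contains_hajosI[OF G] no_hajos by metis
    ultimately have "dense_hajos_free (verts \<Gamma>) (neighbours \<Gamma>)"
      using G assms(1) M neighbours_facts[OF G] by (simp add: dense_hajos_free_def simple_graph_def)
    then show False using four_dvd_card assms(3) M by metis
  qed
qed

section \<open>Lower bounds\<close>

text \<open>
  This is $K_{k,M-k}$ enlarged by the pairs in \<open>I\<close>.
\<close>

definition two_part_graph :: "nat \<Rightarrow> nat \<Rightarrow> (nat \<Rightarrow> nat \<Rightarrow> bool) \<Rightarrow> nat graph" where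
  "two_part_graph k M I = ({..<M},
     {{u, v} | u v. u < M \<and> v < M \<and> u \<noteq> v \<and> ((u < k) \<noteq> (v < k) \<or> I u v)})"

lemma two_part_graph_edge:
  assumes "symp I"
  shows "{u, v} \<in> edges (two_part_graph k M I) \<longleftrightarrow>
    u < M \<and> v < M \<and> u \<noteq> v \<and> ((u < k) \<noteq> (v < k) \<or> I u v)"
  using assms by (auto simp: two_part_graph_def doubleton_eq_iff dest: sympD)

lemma simple_two_part_graph: "simple_graph (two_part_graph k M I)"
  by (auto simp: simple_graph_def two_part_graph_def)

text \<open>
  The set \<open>S\<close> consists of at least \<open>M - n\<close> neighbours of \<open>v\<close>, too many for \<open>v\<close> to be the centre
  of a star with \<open>n\<close> edges in the complement.
\<close>

lemma not_ramsey_two_part_graphI: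
  assumes I: "symp I" and no_hajos: "\<not> contains_subgraph (two_part_graph k M I) hajos_graph"
    and deg: "\<And>v. v < M \<Longrightarrow> \<exists>S. finite S \<and> M \<le> card S + n \<and> v \<notin> S \<and>
      (\<forall>u\<in>S. u < M \<and> ((u < k) \<noteq> (v < k) \<or> I u v))"
  shows "\<not> ramsey_property hajos_graph (star_graph n) M"
proof
  let ?G = "two_part_graph k M I"
  assume "ramsey_property hajos_graph (star_graph n) M"
  moreover have "card (verts ?G) = M" by (simp add: two_part_graph_def)
  ultimately have "contains_subgraph (complement ?G) (star_graph n)"
    using simple_two_part_graph no_hajos unfolding ramsey_property_def by blast
  then obtain v where v: "v < M" "card (neighbours ?G v) + n < M"
    using complement_contains_star_iff[OF simple_two_part_graph] by (auto simp: two_part_graph_def)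
  obtain S where S: "finite S" "M \<le> card S + n" "v \<notin> S"
      "\<And>u. u \<in> S \<Longrightarrow> u < M \<and> ((u < k) \<noteq> (v < k) \<or> I u v)"
    using deg[OF v(1)] by blast
  have "S \<subseteq> neighbours ?G v"
    using S(3,4) v(1) by (auto simp: neighbours_def two_part_graph_edge[OF I])
  moreover have "finite (neighbours ?G v)"
    by (rule finite_subset[of _ "{..<M}"]) (auto simp: neighbours_def two_part_graph_edge[OF I])
  ultimately have "card S \<le> card (neighbours ?G v)" by (metis card_mono)
  then show False using S(2) v(2) by linarith
qed

text \<open>
  The host is $K_{n+1,n}$ with a star spanning the larger part, which gives every vertex degree at
  least $n + 1$.
\<close>

lemma hajos_star_lower:
  assumes "1 \<le> n"
  shows "\<not> ramsey_property hajos_graph (star_graph n) (2 * n + 1)"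
proof -
  define I :: "nat \<Rightarrow> nat \<Rightarrow> bool" where "I u v \<longleftrightarrow> u = 0 \<or> v = 0" for u v
  have sym: "symp I" by (auto simp: I_def symp_def)
  show ?thesis
  proof (rule not_ramsey_two_part_graphI[OF sym, of "n + 1"])
    show "\<not> contains_subgraph (two_part_graph (n + 1) (2 * n + 1) I) hajos_graph"
    proof
      let ?E = "edges (two_part_graph (n + 1) (2 * n + 1) I)"
      assume "contains_subgraph (two_part_graph (n + 1) (2 * n + 1) I) hajos_graph"
      then obtain a b c x y z where d: "distinct [a, b, c, x, y, z]"
        and e: "{a, b} \<in> ?E" "{b, c} \<in> ?E" "{a, c} \<in> ?E" "{a, x} \<in> ?E" "{b, x} \<in> ?E"
          "{b, y} \<in> ?E" "{c, y} \<in> ?E" "{c, z} \<in> ?E" "{a, z} \<in> ?E"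
        by (rule contains_hajosE)
      \<comment> \<open>Every triangle contains the centre of the star, but no vertex of a Haj\'os graph meets all of its
        four triangles.\<close>
      have tri: "u = 0 \<or> v = 0 \<or> w = 0" if "{u, v} \<in> ?E" "{v, w} \<in> ?E" "{u, w} \<in> ?E" for u v w
        using that unfolding two_part_graph_edge[OF sym] I_def by blast
      show False
        using tri[OF e(1,2,3)] tri[OF e(1,5,4)] tri[OF e(2,7,6)] tri[OF e(3,8,9)] d by auto
    qed
  next
    fix v assume v: "v < 2 * n + 1"
    consider "v = 0" | "0 < v" "v < n + 1" | "n + 1 \<le> v" by linarith
    then show "\<exists>S. finite S \<and> 2 * n + 1 \<le> card S + n \<and> v \<notin> S \<and>
      (\<forall>u\<in>S. u < 2 * n + 1 \<and> ((u < n + 1) \<noteq> (v < n + 1) \<or> I u v))"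
    proof cases
      case 1
      then show ?thesis using assms by (intro exI[of _ "{1..2 * n}"]) (auto simp: I_def)
    next
      case 2
      then show ?thesis by (intro exI[of _ "insert 0 {n + 1..<2 * n + 1}"]) (auto simp: I_def)
    next
      case 3
      then show ?thesis by (intro exI[of _ "{..<n + 1}"]) auto
    qed
  qed
qed

text \<open>
  For odd \<open>n\<close> the parts of $K_{n+1,n+1}$ have even size, so each of them carries a perfect matching;
  adding both raises every degree to $n + 2$.
\<close>

lemma hajos_star_lower_odd:
  assumes "odd n"
  shows "\<not> ramsey_property hajos_graph (star_graph n) (2 * n + 2)"
proof -
  \<comment> \<open>The matching pairs \<open>2 * i\<close> with \<open>2 * i + 1\<close>; as \<open>n + 1\<close> is even, no pair meets both parts.\<close>
  define partner :: "nat \<Rightarrow> nat" where "partner v = (if even v then v + 1 else v - 1)" for v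
  define I :: "nat \<Rightarrow> nat \<Rightarrow> bool" where "I u v \<longleftrightarrow> u = partner v" for u v
  have partner: "partner (partner v) = v" "partner v \<noteq> v" for v
    by (auto simp: partner_def elim!: oddE)
  have sym: "symp I" using partner(1) by (auto simp: I_def symp_def)
  have I_unique: "w = w'" if "I v w" "I v w'" for v w w'
    using that partner(1) unfolding I_def by metis
  show ?thesis
  proof (rule not_ramsey_two_part_graphI[OF sym, of "n + 1"])
    show "\<not> contains_subgraph (two_part_graph (n + 1) (2 * n + 2) I) hajos_graph"
    proof
      let ?E = "edges (two_part_graph (n + 1) (2 * n + 2) I)"
      assume "contains_subgraph (two_part_graph (n + 1) (2 * n + 2) I) hajos_graph"
      then obtain a b c x y z where d: "distinct [a, b, c, x, y, z]"
        and e: "{a, b} \<in> ?E" "{b, c} \<in> ?E" "{a, c} \<in> ?E" "{a, x} \<in> ?E" "{b, x} \<in> ?E"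
          "{b, y} \<in> ?E" "{c, y} \<in> ?E" "{c, z} \<in> ?E" "{a, z} \<in> ?E"
        by (rule contains_hajosE)
      have swap: "{v, u} \<in> ?E" if "{u, v} \<in> ?E" for u v
        using that by (simp only: insert_commute)
      have inner: "I u v" if "{u, v} \<in> ?E" "u < n + 1 \<longleftrightarrow> v < n + 1" for u v
        using that by (simp add: two_part_graph_edge[OF sym])
      \<comment> \<open>Two vertices \<open>u\<close>, \<open>v\<close> of a triangle are a matched pair, and the third vertex \<open>w\<close> is in the other
        part. A further common neighbour of \<open>w\<close> with \<open>u\<close> or with \<open>v\<close> can only be the partner of \<open>w\<close>.\<close>
      have same_side: False
        if "{u, v} \<in> ?E" "{v, w} \<in> ?E" "{u, w} \<in> ?E" "{v, p} \<in> ?E" "{w, p} \<in> ?E" "{w, q} \<in> ?E" "{u, q} \<in> ?E"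
          and dist: "distinct [u, v, w, p, q]" and side: "u < n + 1 \<longleftrightarrow> v < n + 1"
        for u v w p q
      proof -
        have uv: "I u v" "I v u" using inner[OF that(1) side] sympD[OF sym] by blast+
        have w: "w < n + 1 \<longleftrightarrow> \<not> u < n + 1"
          using inner[OF that(3)] I_unique[OF uv(1), of w] dist by auto
        have "p < n + 1 \<longleftrightarrow> \<not> v < n + 1"
          using inner[OF that(4)] I_unique[OF uv(2), of p] dist by auto
        then have wp: "I w p" using inner[OF that(5)] w side by auto
        have "q < n + 1 \<longleftrightarrow> \<not> u < n + 1"
          using inner[OF that(7)] I_unique[OF uv(1), of q] dist by auto
        then have "I w q" using inner[OF that(6)] w side by auto
        then show False using I_unique[OF wp] dist by auto
      qed
      consider "a < n + 1 \<longleftrightarrow> b < n + 1" | "b < n + 1 \<longleftrightarrow> c < n + 1" | "c < n + 1 \<longleftrightarrow> a < n + 1"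
        by blast
      then show False
      proof cases
        case 1
        show False using same_side[OF e(1-3) e(6-9) _ 1] d by force
      next
        case 2
        show False using same_side[OF e(2) swap[OF e(3)] swap[OF e(1)] e(8,9,4,5) _ 2] d by force
      next
        case 3
        show False using same_side[OF swap[OF e(3)] e(1) swap[OF e(2)] e(4-7) _ 3] d by force
      qed
    qed
  next
    fix v assume v: "v < 2 * n + 2"
    obtain m where m: "n = 2 * m + 1" using assms by (rule oddE)
    have side: "partner v < n + 1 \<longleftrightarrow> v < n + 1" "partner v < 2 * n + 2"
    proof (atomize(full), cases "even v")
      case True
      then obtain i where i: "v = 2 * i" by (rule evenE)
      then have "i \<le> 2 * m + 1" using v m by linarith
      then show "(partner v < n + 1 \<longleftrightarrow> v < n + 1) \<and> partner v < 2 * n + 2"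
        using i m by (cases "i \<le> m") (auto simp: partner_def)
    next
      case False
      then obtain i where i: "v = 2 * i + 1" by (rule oddE)
      then show "(partner v < n + 1 \<longleftrightarrow> v < n + 1) \<and> partner v < 2 * n + 2"
        using v m by (cases "i \<le> m") (auto simp: partner_def)
    qed
    show "\<exists>S. finite S \<and> 2 * n + 2 \<le> card S + n \<and> v \<notin> S \<and>
      (\<forall>u\<in>S. u < 2 * n + 2 \<and> ((u < n + 1) \<noteq> (v < n + 1) \<or> I u v))"
      using v partner(2)[of v] partner(2)[of v, symmetric] side
      by (intro exI[of _ "insert (partner v) (if v < n + 1 then {n + 1..<2 * n + 2} else {..<n + 1})"])
         (auto simp: I_def)
  qed
qed

theorem theorem1:
  fixes n :: nat
  shows "(even n \<and> n \<ge> 2 \<longrightarrow> ramsey_number hajos_graph (star_graph n) = 2 * n + 2) \<and>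
         (odd n \<and> n \<ge> 3 \<longrightarrow> ramsey_number hajos_graph (star_graph n) = 2 * n + 3)"
proof (intro conjI impI)
  assume n: "even n \<and> n \<ge> 2"
  then have "\<not> 4 dvd 2 * n + 2" by presburger
  then have "ramsey_property hajos_graph (star_graph n) (Suc (2 * n + 1))"
    using hajos_star_upper[of "2 * n + 2" n] n by simp
  from ramsey_number_eqI[OF this hajos_star_lower]
  show "ramsey_number hajos_graph (star_graph n) = 2 * n + 2" using n by simp
next
  assume n: "odd n \<and> n \<ge> 3"
  have "\<not> 4 dvd 2 * n + 3" by presburger
  then have "ramsey_property hajos_graph (star_graph n) (Suc (2 * n + 2))"
    using hajos_star_upper[of "2 * n + 3" n] n by (simp add: numeral_3_eq_3)
  from ramsey_number_eqI[OF this hajos_star_lower_odd]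
  show "ramsey_number hajos_graph (star_graph n) = 2 * n + 3" using n by simp
qed

end
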